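(* For $n\in\mathbb{N}_0$ let $$R_n(x)={}_3F_2\left(\begin{matrix}-n,\ n-\alpha_3+\alpha_1+\alpha_2+1,\ -x\\ \alpha_1+1,\ \alpha_2+1\end{matrix};1\right)=\sum_{k=0}^n\frac{(-n)_k(n-\alpha_3+\alpha_1+\alpha_2+1)_k(-x)_k}{(\alpha_1+1)_k(\alpha_2+1)_k\,k!}.$$ Then $R_n$ satisfies $$D(R_n(x))=n(\alpha_3-\alpha_1-\alpha_2-1-n)R_n(x),$$ where $$D=-x(x+\alpha_3)\nabla\triangle+\big((\alpha_3-\alpha_1-\alpha_2-2)x-(1+\alpha_1)(1+\alpha_2)\big)\triangle,$$ and the orthogonality relation $$\sum_{x=0}^\infty R_n(x)R_m(x)\frac{(\alpha_1+1)_x(\alpha_2+1)_x}{x!\,(\alpha_3+1)_x}=0$$ for $n\neq m$ such that $n+m<\alpha_3-\alpha_1-\alpha_2-1$.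
   Context: $\triangle f(x)=f(x+1)-f(x)$, $\nabla f(x)=f(x)-f(x-1)$ for functions of one variable; $(y)_k=y(y+1)\cdots(y+k-1)$, $(y)_0=1$. The parameters satisfy: $\alpha_3>0$ and $\alpha_1,\alpha_2$ satisfy one of: (i) $\alpha_1,\alpha_2$ are both positive reals, or there is a negative integer $\kappa$ with $\alpha_1,\alpha_2\in(\kappa,\kappa+1)$; (ii) $\alpha_2=\bar\alpha_1\in\mathbb{C}\setminus\mathbb{R}$. *)

theory Defs
  imports "HOL-Analysis.Analysis"
begin

definition fwd_diff :: "(complex \<Rightarrow> complex) \<Rightarrow> complex \<Rightarrow> complex" where
  "fwd_diff f x = f (x + 1) - f x"

definition bwd_diff :: "(complex \<Rightarrow> complex) \<Rightarrow> complex \<Rightarrow> complex" where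
  "bwd_diff f x = f x - f (x - 1)"

definition admissible :: "complex \<Rightarrow> complex \<Rightarrow> real \<Rightarrow> bool" where
  "admissible \<alpha>1 \<alpha>2 \<alpha>3 \<longleftrightarrow> \<alpha>3 > 0 \<and>
     ((\<exists>a b :: real. \<alpha>1 = of_real a \<and> \<alpha>2 = of_real b \<and>
         ((a > 0 \<and> b > 0) \<or>
          (\<exists>\<kappa>::int. \<kappa> < 0 \<and> a \<in> {of_int \<kappa><..<of_int (\<kappa> + 1)} \<and>
                                b \<in> {of_int \<kappa><..<of_int (\<kappa> + 1)})))
      \<or> (\<alpha>1 \<notin> \<real> \<and> \<alpha>2 = cnj \<alpha>1))"

text \<open>The polynomial \<open>R n\<close>, as the hypergeometric series \<open>\<^sub>3F\<^sub>2\<close> at the argument \<open>1\<close>. The series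
  terminates because \<open>pochhammer (- of_nat n) k = 0\<close> for \<open>k > n\<close>.\<close>

definition R_poly :: "complex \<Rightarrow> complex \<Rightarrow> real \<Rightarrow> nat \<Rightarrow> complex \<Rightarrow> complex" where
  "R_poly \<alpha>1 \<alpha>2 \<alpha>3 n x =
     eval_fps (fps_hypergeo [- of_nat n, of_nat n - of_real \<alpha>3 + \<alpha>1 + \<alpha>2 + 1, - x]
                            [\<alpha>1 + 1, \<alpha>2 + 1] 1) 1"

definition D_op ::
  "complex \<Rightarrow> complex \<Rightarrow> real \<Rightarrow> (complex \<Rightarrow> complex) \<Rightarrow> complex \<Rightarrow> complex" where
  "D_op \<alpha>1 \<alpha>2 \<alpha>3 f x =
     - x * (x + of_real \<alpha>3) * bwd_diff (fwd_diff f) x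
     + ((of_real \<alpha>3 - \<alpha>1 - \<alpha>2 - 2) * x - (1 + \<alpha>1) * (1 + \<alpha>2)) * fwd_diff f x"

definition weight :: "complex \<Rightarrow> complex \<Rightarrow> real \<Rightarrow> nat \<Rightarrow> complex" where
  "weight \<alpha>1 \<alpha>2 \<alpha>3 x =
     pochhammer (\<alpha>1 + 1) x * pochhammer (\<alpha>2 + 1) x
       / (fact x * pochhammer (of_real \<alpha>3 + 1) x)"

end

theory Submission
  imports Defs
begin

text \<open>
  The operator lowers the factorial basis: with \<open>A = \<alpha>3 - \<alpha>1 - \<alpha>2 - 2\<close>, it sends
  \<open>p k x = pochhammer (- x) k\<close> to
  \<open>k * (A + 1 - k) * p k + k * (k + \<alpha>1) * (k + \<alpha>2) * p (k - 1)\<close>.  The eigenvalue equation for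
  \<open>\<Sum>k. c k * p k\<close> with eigenvalue \<open>n * (A + 1 - n)\<close> is therefore a two-term recurrence for the
  coefficients \<open>c k\<close>, and the hypergeometric coefficients solve it (lemma \<open>r_coeff_rec\<close>).

  For the orthogonality, the operator is written as
  \<open>- (x + 1 + \<alpha>1) * (x + 1 + \<alpha>2) * \<Delta> + x * (x + \<alpha>3) * \<nabla>\<close>.  The Pearson relation
  \<open>w x * (x + 1 + \<alpha>1) * (x + 1 + \<alpha>2) = w (x + 1) * (x + 1) * (x + 1 + \<alpha>3)\<close>
  for the weight \<open>w\<close> makes it formally self-adjoint: the partial sums of
  \<open>w * (R m * D (R n) - R n * D (R m))\<close> telescope to a single boundary term, a multiple of the
  Casorati determinant \<open>R m * \<Delta> (R n) - R n * \<Delta> (R m)\<close>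
  (lemma \<open>summation_by_parts_D_op\<close>).  That determinant grows at most like \<open>x ^ (n + m - 1)\<close>, and
  Euler's limit for the Gamma function shows that its factor grows at most like
  \<open>x powr (Re (\<alpha>1 + \<alpha>2) - \<alpha>3 + 2)\<close>.  Under the degree condition the boundary term hence tends
  to \<open>0\<close>; the same condition keeps the two eigenvalues different, so one can divide by their
  difference.
\<close>

section \<open>The series as a finite sum\<close>

text \<open>The coefficient of \<open>R_poly \<alpha>1 \<alpha>2 \<alpha>3 n\<close> at \<open>pochhammer (- x) k\<close>; it is \<open>0\<close> for \<open>k > n\<close>.\<close>

definition r_coeff :: "complex \<Rightarrow> complex \<Rightarrow> real \<Rightarrow> nat \<Rightarrow> nat \<Rightarrow> complex" where
  "r_coeff \<alpha>1 \<alpha>2 \<alpha>3 n k =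
     pochhammer (- of_nat n) k * pochhammer (of_nat n - of_real \<alpha>3 + \<alpha>1 + \<alpha>2 + 1) k
       / (pochhammer (\<alpha>1 + 1) k * pochhammer (\<alpha>2 + 1) k * fact k)"

lemma r_coeff_eq_0: "k > n \<Longrightarrow> r_coeff \<alpha>1 \<alpha>2 \<alpha>3 n k = 0"
  by (simp add: r_coeff_def pochhammer_of_nat_eq_0_lemma)

lemma R_poly_eq_sum:
  "R_poly \<alpha>1 \<alpha>2 \<alpha>3 n x = (\<Sum>k\<le>n. r_coeff \<alpha>1 \<alpha>2 \<alpha>3 n k * pochhammer (- x) k)"
proof -
  have "R_poly \<alpha>1 \<alpha>2 \<alpha>3 n x = (\<Sum>k. r_coeff \<alpha>1 \<alpha>2 \<alpha>3 n k * pochhammer (- x) k)"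
    by (simp add: R_poly_def eval_fps_def r_coeff_def)
  also have "\<dots> = (\<Sum>k\<le>n. r_coeff \<alpha>1 \<alpha>2 \<alpha>3 n k * pochhammer (- x) k)"
    by (rule suminf_finite) (auto simp: r_coeff_eq_0)
  finally show ?thesis .
qed

section \<open>The eigenvalue equation\<close>

lemma fwd_diff_pochhammer:
  "fwd_diff (\<lambda>x. pochhammer (- x) k) x = - of_nat k * pochhammer (- x) (k - 1)"
proof (cases k)
  case (Suc j)
  have "pochhammer (- (x + 1)) (Suc j) = (- x - 1) * pochhammer (- x) j"
    by (simp add: pochhammer_rec)
  then show ?thesis
    by (simp add: fwd_diff_def Suc pochhammer_rec' algebra_simps)
qed (simp add: fwd_diff_def)

lemma bwd_diff_pochhammer:
  "x * bwd_diff (\<lambda>x. pochhammer (- x) k) x = of_nat k * pochhammer (- x) k"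
proof -
  have "- x * pochhammer (- x + 1) k = (- x + of_nat k) * pochhammer (- x) k"
    by (metis pochhammer_rec pochhammer_rec')
  then show ?thesis
    by (simp add: bwd_diff_def algebra_simps)
qed

lemma D_op_pochhammer:
  "D_op \<alpha>1 \<alpha>2 \<alpha>3 (\<lambda>x. pochhammer (- x) k) x =
     of_nat k * (of_real \<alpha>3 - \<alpha>1 - \<alpha>2 - 1 - of_nat k) * pochhammer (- x) k
     + of_nat k * (of_nat k + \<alpha>1) * (of_nat k + \<alpha>2) * pochhammer (- x) (k - 1)"
proof (cases k)
  case 0
  then show ?thesis by (simp add: D_op_def bwd_diff_def fwd_diff_def)
next
  case (Suc j)
  have "x * bwd_diff (fwd_diff (\<lambda>x. pochhammer (- x) k)) x
      = - of_nat k * (x * bwd_diff (\<lambda>x. pochhammer (- x) j) x)"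
    unfolding bwd_diff_def fwd_diff_pochhammer by (simp add: Suc algebra_simps)
  also have "\<dots> = - of_nat k * (of_nat j * pochhammer (- x) j)"
    by (simp only: bwd_diff_pochhammer)
  finally have bwd: "x * bwd_diff (fwd_diff (\<lambda>x. pochhammer (- x) k)) x
      = - of_nat k * (of_nat j * pochhammer (- x) j)" .
  have "D_op \<alpha>1 \<alpha>2 \<alpha>3 (\<lambda>x. pochhammer (- x) k) x =
      - (x + of_real \<alpha>3) * (x * bwd_diff (fwd_diff (\<lambda>x. pochhammer (- x) k)) x)
      + ((of_real \<alpha>3 - \<alpha>1 - \<alpha>2 - 2) * x - (1 + \<alpha>1) * (1 + \<alpha>2))
          * fwd_diff (\<lambda>x. pochhammer (- x) k) x"
    by (simp only: D_op_def mult_minus_left mult_minus_right mult_ac)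
  also have "\<dots> = - (x + of_real \<alpha>3) * (- of_nat k * (of_nat j * pochhammer (- x) j))
      + ((of_real \<alpha>3 - \<alpha>1 - \<alpha>2 - 2) * x - (1 + \<alpha>1) * (1 + \<alpha>2))
          * (- of_nat k * pochhammer (- x) j)"
    unfolding bwd fwd_diff_pochhammer by (simp add: Suc)
  finally show ?thesis
    by (simp add: Suc pochhammer_rec' algebra_simps)
qed

lemma D_op_sum:
  "D_op \<alpha>1 \<alpha>2 \<alpha>3 (\<lambda>x. \<Sum>k\<in>S. c k * f k x) x = (\<Sum>k\<in>S. c k * D_op \<alpha>1 \<alpha>2 \<alpha>3 (f k) x)"
proof -
  define u where "u = - x * (x + of_real \<alpha>3)"
  define v where "v = (of_real \<alpha>3 - \<alpha>1 - \<alpha>2 - 2) * x - (1 + \<alpha>1) * (1 + \<alpha>2)"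
  have *: "D_op \<alpha>1 \<alpha>2 \<alpha>3 f x = u * f (x - 1) + ((- 2 * u - v) * f x + (u + v) * f (x + 1))" for f
    unfolding D_op_def u_def [symmetric] v_def [symmetric]
    by (simp add: bwd_diff_def fwd_diff_def algebra_simps)
  show ?thesis
    unfolding * by (simp only: sum_distrib_left sum.distrib [symmetric] distrib_left ac_simps)
qed

lemma r_coeff_rec:
  assumes "\<alpha>1 + 1 \<notin> \<int>\<^sub>\<le>\<^sub>0" "\<alpha>2 + 1 \<notin> \<int>\<^sub>\<le>\<^sub>0"
  shows "r_coeff \<alpha>1 \<alpha>2 \<alpha>3 n (Suc k) * (of_nat (Suc k) * (of_nat (Suc k) + \<alpha>1) * (of_nat (Suc k) + \<alpha>2))
    = r_coeff \<alpha>1 \<alpha>2 \<alpha>3 n k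
        * ((of_nat k - of_nat n) * (of_nat n + of_nat k - of_real \<alpha>3 + \<alpha>1 + \<alpha>2 + 1))"
proof -
  have "\<alpha>1 + 1 + of_nat k \<noteq> 0" "\<alpha>2 + 1 + of_nat k \<noteq> 0"
    using assms plus_of_nat_eq_0_imp by blast+
  moreover have "(1 + of_nat k :: complex) \<noteq> 0"
    by (metis of_nat_Suc of_nat_eq_0_iff nat.distinct(1))
  ultimately show ?thesis
    unfolding r_coeff_def pochhammer_Suc fact_Suc
    by (simp add: divide_simps) (simp add: algebra_simps)
qed

lemma D_op_R_poly:
  assumes "\<alpha>1 + 1 \<notin> \<int>\<^sub>\<le>\<^sub>0" "\<alpha>2 + 1 \<notin> \<int>\<^sub>\<le>\<^sub>0"
  shows "D_op \<alpha>1 \<alpha>2 \<alpha>3 (R_poly \<alpha>1 \<alpha>2 \<alpha>3 n) x =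
    of_nat n * (of_real \<alpha>3 - \<alpha>1 - \<alpha>2 - 1 - of_nat n) * R_poly \<alpha>1 \<alpha>2 \<alpha>3 n x"
proof -
  define c where "c = r_coeff \<alpha>1 \<alpha>2 \<alpha>3 n"
  define ev where "ev k = of_nat k * (of_real \<alpha>3 - \<alpha>1 - \<alpha>2 - 1 - of_nat k)" for k
  define g where
    "g k = c k * (of_nat k * (of_nat k + \<alpha>1) * (of_nat k + \<alpha>2)) * pochhammer (- x) (k - 1)" for k
  have c_Suc: "c (Suc n) = 0"
    by (simp add: c_def r_coeff_eq_0)
  have R: "R_poly \<alpha>1 \<alpha>2 \<alpha>3 n = (\<lambda>x. \<Sum>k\<le>n. c k * pochhammer (- x) k)"
    by (rule ext) (simp add: R_poly_eq_sum c_def)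
  have "D_op \<alpha>1 \<alpha>2 \<alpha>3 (R_poly \<alpha>1 \<alpha>2 \<alpha>3 n) x = (\<Sum>k\<le>n. c k * ev k * pochhammer (- x) k + g k)"
    unfolding R D_op_sum D_op_pochhammer
    by (rule sum.cong) (simp_all add: ev_def g_def algebra_simps)
  also have "\<dots> = (\<Sum>k\<le>n. c k * ev k * pochhammer (- x) k) + (\<Sum>k\<le>n. g k)"
    by (rule sum.distrib)
  also have "(\<Sum>k\<le>n. g k) = (\<Sum>k\<le>Suc n. g k)"
    by (simp add: g_def c_Suc)
  also have "\<dots> = (\<Sum>k\<le>n. g (Suc k))"
    by (subst sum.atMost_Suc_shift) (simp add: g_def)
  also have "(\<Sum>k\<le>n. c k * ev k * pochhammer (- x) k) + (\<Sum>k\<le>n. g (Suc k))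
      = (\<Sum>k\<le>n. ev n * (c k * pochhammer (- x) k))"
    unfolding sum.distrib [symmetric]
  proof (rule sum.cong)
    fix k
    have "g (Suc k) = c k * ((of_nat k - of_nat n)
        * (of_nat n + of_nat k - of_real \<alpha>3 + \<alpha>1 + \<alpha>2 + 1)) * pochhammer (- x) k"
      unfolding g_def c_def r_coeff_rec [OF assms] by simp
    also have "(of_nat k - of_nat n) * (of_nat n + of_nat k - of_real \<alpha>3 + \<alpha>1 + \<alpha>2 + 1)
        = ev n - ev k"
      by (simp add: ev_def algebra_simps)
    finally show "c k * ev k * pochhammer (- x) k + g (Suc k) = ev n * (c k * pochhammer (- x) k)"
      by (simp add: algebra_simps)
  qed simp
  also have "\<dots> = ev n * R_poly \<alpha>1 \<alpha>2 \<alpha>3 n x"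
    by (simp add: R sum_distrib_left)
  finally show ?thesis
    by (simp add: ev_def)
qed

section \<open>Summation by parts\<close>

lemma D_op_eq:
  "D_op \<alpha>1 \<alpha>2 \<alpha>3 f x =
     - (x + 1 + \<alpha>1) * (x + 1 + \<alpha>2) * fwd_diff f x + x * (x + of_real \<alpha>3) * bwd_diff f x"
  by (simp add: D_op_def fwd_diff_def bwd_diff_def algebra_simps)

lemma weight_Pearson:
  assumes "\<alpha>3 > 0"
  shows "weight \<alpha>1 \<alpha>2 \<alpha>3 (Suc k) * (of_nat (Suc k) * (of_nat (Suc k) + of_real \<alpha>3))
    = weight \<alpha>1 \<alpha>2 \<alpha>3 k * ((of_nat k + 1 + \<alpha>1) * (of_nat k + 1 + \<alpha>2))"
proof -
  have "of_nat (Suc k) + of_real \<alpha>3 = (of_real (real (Suc k) + \<alpha>3) :: complex)"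
    by simp
  also have "\<dots> \<noteq> 0"
    unfolding of_real_eq_0_iff using assms by linarith
  finally have nz: "of_nat (Suc k) + of_real \<alpha>3 \<noteq> (0 :: complex)" .
  have cancel: "P * a * (Q * b) / (s * F * (G * t)) * (s * t) = P * Q / (F * G) * (a * b)"
    if "s \<noteq> 0" "t \<noteq> 0" for P Q F G a b s t :: complex
    using that by simp
  have shift: "\<alpha>1 + 1 + of_nat k = of_nat k + 1 + \<alpha>1" "\<alpha>2 + 1 + of_nat k = of_nat k + 1 + \<alpha>2"
    "of_real \<alpha>3 + 1 + of_nat k = of_nat (Suc k) + complex_of_real \<alpha>3"
    by simp_all
  show ?thesis
    unfolding weight_def pochhammer_Suc fact_Suc shift
    by (rule cancel [OF _ nz]) (simp del: of_nat_Suc)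
qed

text \<open>The Casorati determinant of \<open>f\<close> and \<open>g\<close>, the discrete counterpart of the Wronskian.\<close>

definition casorati :: "(complex \<Rightarrow> complex) \<Rightarrow> (complex \<Rightarrow> complex) \<Rightarrow> complex \<Rightarrow> complex" where
  "casorati f g x = g x * fwd_diff f x - f x * fwd_diff g x"

text \<open>
  Lagrange's identity for the operator, summed over \<open>0, \<dots>, N\<close>.  There is no boundary term at
  \<open>x = 0\<close>, because the coefficient of \<open>\<nabla>\<close> vanishes there.
\<close>

lemma summation_by_parts_D_op:
  assumes "\<alpha>3 > 0"
  shows "(\<Sum>x\<le>N. weight \<alpha>1 \<alpha>2 \<alpha>3 x * (g (of_nat x) * D_op \<alpha>1 \<alpha>2 \<alpha>3 f (of_nat x)
                                   - f (of_nat x) * D_op \<alpha>1 \<alpha>2 \<alpha>3 g (of_nat x)))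
    = - (weight \<alpha>1 \<alpha>2 \<alpha>3 (Suc N) * (of_nat (Suc N) * (of_nat (Suc N) + of_real \<alpha>3)))
        * casorati f g (of_nat N)"
proof -
  define w where "w = weight \<alpha>1 \<alpha>2 \<alpha>3"
  define E where "E x = (of_nat x + 1 + \<alpha>1) * (of_nat x + 1 + \<alpha>2)" for x
  define C where "C x = of_nat x * (of_nat x + complex_of_real \<alpha>3)" for x
  have Pearson: "w (Suc k) * C (Suc k) = w k * E k" for k
    unfolding w_def C_def E_def by (rule weight_Pearson) fact
  have local: "g (of_nat x) * D_op \<alpha>1 \<alpha>2 \<alpha>3 f (of_nat x) - f (of_nat x) * D_op \<alpha>1 \<alpha>2 \<alpha>3 g (of_nat x)
      = - E x * casorati f g (of_nat x) + C x * casorati f g (of_nat x - 1)" for x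
    by (simp add: D_op_eq casorati_def E_def C_def fwd_diff_def bwd_diff_def algebra_simps)
  have "(\<Sum>x\<le>N. w x * (- E x * casorati f g (of_nat x) + C x * casorati f g (of_nat x - 1)))
      = - (w N * E N) * casorati f g (of_nat N)"
  proof (induction N)
    case 0
    show ?case by (simp add: C_def)
  next
    case (Suc N)
    have pred: "(of_nat (Suc N) - 1 :: complex) = of_nat N" by simp
    have "w (Suc N) * (- E (Suc N) * casorati f g (of_nat (Suc N))
          + C (Suc N) * casorati f g (of_nat (Suc N) - 1))
        = - (w (Suc N) * E (Suc N)) * casorati f g (of_nat (Suc N))
          + w (Suc N) * C (Suc N) * casorati f g (of_nat N)"
      unfolding pred by (simp add: algebra_simps del: of_nat_Suc)
    then show ?case
      by (simp only: sum.atMost_Suc Suc Pearson) (simp add: algebra_simps)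
  qed
  then show ?thesis
    unfolding local [symmetric] Pearson [symmetric] by (simp only: w_def C_def)
qed

section \<open>Growth of the boundary term\<close>

lemma bigo_of_nat_power_mono:
  assumes "j \<le> k"
  shows "(\<lambda>N. of_nat N ^ j :: complex) \<in> O(\<lambda>N. of_nat N ^ k)"
proof (rule bigoI [of _ 1])
  show "\<forall>\<^sub>F N in sequentially. norm (of_nat N ^ j :: complex) \<le> 1 * norm (of_nat N ^ k :: complex)"
    using eventually_ge_at_top [of 1]
    by eventually_elim (simp add: norm_power power_increasing assms)
qed

lemma of_nat_add_const_bigo: "(\<lambda>N. of_nat N + c :: complex) \<in> O(\<lambda>N. of_nat N)"
proof -
  have "(\<lambda>_::nat. c) \<in> O(\<lambda>N. of_nat N ^ 1)"
    by (rule landau_o.big_trans [OF bigo_const]) (use bigo_of_nat_power_mono [of 0 1] in simp)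
  then show ?thesis
    by (intro sum_in_bigo) simp_all
qed

lemma pochhammer_minus_of_nat_bigo:
  "(\<lambda>N. pochhammer (- of_nat N) k :: complex) \<in> O(\<lambda>N. of_nat N ^ k)"
proof (induction k)
  case (Suc k)
  have "(\<lambda>N. - (of_nat N + - of_nat k) :: complex) \<in> O(\<lambda>N. of_nat N)"
    by (simp only: landau_o.big.uminus_in_iff of_nat_add_const_bigo)
  from landau_o.big.mult [OF this Suc] show ?case
    by (simp add: pochhammer_rec')
qed simp

lemma R_poly_bigo: "(\<lambda>N. R_poly \<alpha>1 \<alpha>2 \<alpha>3 n (of_nat N)) \<in> O(\<lambda>N. of_nat N ^ n)"
  unfolding R_poly_eq_sum
proof (intro big_sum_in_bigo)
  fix k assume "k \<in> {..n}"
  then have "(\<lambda>N. pochhammer (- of_nat N) k :: complex) \<in> O(\<lambda>N. of_nat N ^ n)"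
    by (intro landau_o.big_trans [OF pochhammer_minus_of_nat_bigo bigo_of_nat_power_mono]) simp
  then show "(\<lambda>N. r_coeff \<alpha>1 \<alpha>2 \<alpha>3 n k * pochhammer (- of_nat N) k) \<in> O(\<lambda>N. of_nat N ^ n)"
    by simp
qed

lemma fwd_diff_R_poly:
  "fwd_diff (R_poly \<alpha>1 \<alpha>2 \<alpha>3 n) x =
     (\<Sum>k\<le>n. r_coeff \<alpha>1 \<alpha>2 \<alpha>3 n k * (- of_nat k * pochhammer (- x) (k - 1)))"
  unfolding fwd_diff_pochhammer [symmetric]
  by (simp add: fwd_diff_def R_poly_eq_sum sum_subtractf algebra_simps)

lemma fwd_diff_R_poly_bigo:
  "(\<lambda>N. fwd_diff (R_poly \<alpha>1 \<alpha>2 \<alpha>3 n) (of_nat N)) \<in> O(\<lambda>N. of_nat N ^ (n - 1))"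
  unfolding fwd_diff_R_poly
proof (intro big_sum_in_bigo)
  fix k assume "k \<in> {..n}"
  then have "(\<lambda>N. pochhammer (- of_nat N) (k - 1) :: complex) \<in> O(\<lambda>N. of_nat N ^ (n - 1))"
    by (intro landau_o.big_trans [OF pochhammer_minus_of_nat_bigo bigo_of_nat_power_mono]) simp
  from landau_o.big.mult [OF bigo_const this, of "r_coeff \<alpha>1 \<alpha>2 \<alpha>3 n k * - of_nat k"]
  show "(\<lambda>N. r_coeff \<alpha>1 \<alpha>2 \<alpha>3 n k * (- of_nat k * pochhammer (- of_nat N) (k - 1)))
      \<in> O(\<lambda>N. of_nat N ^ (n - 1))"
    by (simp only: mult.assoc mult_1_left)
qed

lemma casorati_R_poly_bigo:
  "(\<lambda>N. casorati (R_poly \<alpha>1 \<alpha>2 \<alpha>3 n) (R_poly \<alpha>1 \<alpha>2 \<alpha>3 m) (of_nat N))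
     \<in> O(\<lambda>N. of_nat N ^ (n + m - 1))"
proof -
  have *: "(\<lambda>N. R_poly \<alpha>1 \<alpha>2 \<alpha>3 m (of_nat N) * fwd_diff (R_poly \<alpha>1 \<alpha>2 \<alpha>3 n) (of_nat N))
      \<in> O(\<lambda>N. of_nat N ^ (n + m - 1))" for n m
  proof (cases n)
    case 0
    \<comment> \<open>The truncated exponent \<open>n - 1\<close> would give only \<open>N ^ m\<close>, but the difference vanishes.\<close>
    then show ?thesis by (simp add: fwd_diff_R_poly)
  next
    case (Suc j)
    then show ?thesis
      using landau_o.big.mult [OF R_poly_bigo fwd_diff_R_poly_bigo, of \<alpha>1 \<alpha>2 \<alpha>3 m \<alpha>1 \<alpha>2 \<alpha>3 n]
      by (simp add: power_add mult.commute)
  qed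
  show ?thesis
    unfolding casorati_def using * [of n m] * [of m n]
    by (intro sum_in_bigo) (simp_all add: add.commute)
qed

text \<open>
  Euler's limit for the Gamma function, applied to each of the three Pochhammer symbols in the
  weight.  The exponential is \<open>N\<close> to the complex power \<open>\<alpha>1 + \<alpha>2 - \<alpha>3 + 1\<close>.
\<close>

lemma weight_bigo:
  "(\<lambda>N. weight \<alpha>1 \<alpha>2 \<alpha>3 (Suc N) * (of_nat (Suc N) * (of_nat (Suc N) + of_real \<alpha>3)))
    \<in> O(\<lambda>N. of_nat N * exp ((\<alpha>1 + \<alpha>2 - of_real \<alpha>3 + 1) * of_real (ln (of_nat N))))"
proof -
  define G where "G N = rGamma_series (\<alpha>1 + 1) N * rGamma_series (\<alpha>2 + 1) N
    * Gamma_series (of_real \<alpha>3 + 1) N" for N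
  define e where "e N = exp ((\<alpha>1 + \<alpha>2 - of_real \<alpha>3 + 1) * of_real (ln (of_nat N)))" for N :: nat
  have "G \<longlonglongrightarrow> rGamma (\<alpha>1 + 1) * rGamma (\<alpha>2 + 1) * Gamma (of_real \<alpha>3 + 1)"
    unfolding G_def by (intro tendsto_intros)
  then have G: "G \<in> O(\<lambda>_. 1)"
    by (intro bigoI_tendsto) auto
  have "(\<lambda>N. of_nat N + of_real (1 + \<alpha>3) :: complex) \<in> O(\<lambda>N. of_nat N)"
    by (rule of_nat_add_const_bigo)
  moreover have "(\<lambda>N. of_nat N + of_real (1 + \<alpha>3)) = (\<lambda>N. of_nat (Suc N) + complex_of_real \<alpha>3)"
    by (simp add: algebra_simps)
  ultimately have "(\<lambda>N. G N * ((of_nat (Suc N) + of_real \<alpha>3) * e N)) \<in> O(\<lambda>N. 1 * (of_nat N * e N))"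
    by (intro landau_o.big.mult G) simp_all
  moreover have "weight \<alpha>1 \<alpha>2 \<alpha>3 (Suc N) * (of_nat (Suc N) * (of_nat (Suc N) + of_real \<alpha>3))
      = G N * ((of_nat (Suc N) + of_real \<alpha>3) * e N)" for N
  proof -
    define L where "L = complex_of_real (ln (of_nat N))"
    have e: "exp ((of_real \<alpha>3 + 1) * L) * e N = exp ((\<alpha>1 + 1) * L) * exp ((\<alpha>2 + 1) * L)"
      unfolding e_def L_def [symmetric] exp_add [symmetric] by (simp add: algebra_simps)
    have cancel: "p * q / (s * F * r) * (s * t)
        = p / (F * x) * (q / (F * y)) * (F * z / r) * (t * e')"
      if "z * e' = x * y" "s \<noteq> 0" "F \<noteq> 0" "x \<noteq> 0" "y \<noteq> 0"
      for p q r s t F x y z e' :: complex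
    proof -
      have "p / (F * x) * (q / (F * y)) * (F * z / r) * (t * e')
          = p * q * t * (z * e') / (F * (x * y) * r)"
        using that(3) by (simp add: mult_ac)
      also have "\<dots> = p * q / (s * F * r) * (s * t)"
        using that by simp
      finally show ?thesis ..
    qed
    show ?thesis
      unfolding weight_def G_def rGamma_series_def Gamma_series_def fact_Suc L_def [symmetric]
        Suc_eq_plus1 [symmetric]
      by (rule cancel [OF e]) (simp_all del: of_nat_Suc)
  qed
  ultimately show ?thesis
    by (simp only: e_def mult_1_left)
qed

lemma boundary_term_tendsto_0:
  assumes "n \<noteq> m" "real n + real m < \<alpha>3 - Re (\<alpha>1 + \<alpha>2) - 1"
  shows "(\<lambda>N. - (weight \<alpha>1 \<alpha>2 \<alpha>3 (Suc N) * (of_nat (Suc N) * (of_nat (Suc N) + of_real \<alpha>3)))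
           * casorati (R_poly \<alpha>1 \<alpha>2 \<alpha>3 n) (R_poly \<alpha>1 \<alpha>2 \<alpha>3 m) (of_nat N)) \<longlonglongrightarrow> 0"
    (is "?H \<longlonglongrightarrow> 0")
proof -
  define s where "s = Re (\<alpha>1 + \<alpha>2) - \<alpha>3 + 1 + real (n + m)"
  have "s < 0"
    using assms(2) by (simp add: s_def)
  define h where "h N = of_nat N * exp ((\<alpha>1 + \<alpha>2 - of_real \<alpha>3 + 1) * of_real (ln (of_nat N)))
    * of_nat N ^ (n + m - 1)" for N :: nat
  have bigo: "?H \<in> O(h)"
    unfolding h_def
    by (intro landau_o.big.mult casorati_R_poly_bigo)
      (simp only: landau_o.big.uminus_in_iff weight_bigo)
  have "(\<lambda>N. norm (h N)) \<longlonglongrightarrow> 0"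
  proof (rule Lim_transform_eventually)
    show "(\<lambda>N. real N powr s) \<longlonglongrightarrow> 0"
      by (rule tendsto_neg_powr [OF \<open>s < 0\<close> filterlim_real_sequentially])
    show "\<forall>\<^sub>F N in sequentially. real N powr s = norm (h N)"
      using eventually_gt_at_top [of 0]
    proof eventually_elim
      case (elim N)
      \<comment> \<open>The exponent of the power in \<open>h\<close> is not truncated, since \<open>n \<noteq> m\<close> excludes \<open>n = m = 0\<close>.\<close>
      have "norm (h N) = real N ^ Suc (n + m - 1) * exp ((Re (\<alpha>1 + \<alpha>2) - \<alpha>3 + 1) * ln (real N))"
        by (simp add: h_def norm_mult norm_power)
      also have "Suc (n + m - 1) = n + m"
        using assms(1) by simp
      also have "real N ^ (n + m) * exp ((Re (\<alpha>1 + \<alpha>2) - \<alpha>3 + 1) * ln (real N)) = real N powr s"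
        using elim powr_realpow [of "real N" "n + m"]
          powr_add [of "real N" "real (n + m)" "Re (\<alpha>1 + \<alpha>2) - \<alpha>3 + 1"]
        by (simp add: s_def powr_def add.commute)
      finally show ?case ..
    qed
  qed
  then have "h \<longlonglongrightarrow> 0"
    by (rule tendsto_norm_zero_cancel)
  then have "h \<in> o(\<lambda>_. 1)"
    by (intro smalloI_tendsto) auto
  with bigo have "?H \<in> o(\<lambda>_. 1)"
    by (rule landau_o.big_small_trans)
  then show ?thesis
    using smalloD_tendsto by fastforce
qed

section \<open>Admissible parameters and orthogonality\<close>

text \<open>
  Neither parameter is a negative integer: a positive number and a number strictly between two
  consecutive integers are not, nor is a non-real one.  So the denominators of the hypergeometric
  coefficients do not vanish.
\<close>

lemma admissible_imp:
  assumes "admissible \<alpha>1 \<alpha>2 \<alpha>3"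
  shows "\<alpha>3 > 0" "\<alpha>1 + 1 \<notin> \<int>\<^sub>\<le>\<^sub>0" "\<alpha>2 + 1 \<notin> \<int>\<^sub>\<le>\<^sub>0"
proof -
  show "\<alpha>3 > 0"
    using assms by (simp add: admissible_def)
  have nonpos: "\<exists>k::int. k < 0 \<and> z = of_int k" if "z + 1 \<in> \<int>\<^sub>\<le>\<^sub>0" for z :: complex
  proof -
    from that obtain j :: int where "j \<le> 0" "z + 1 = of_int j"
      by (auto elim: nonpos_Ints_cases)
    then have "z = of_int (j - 1)" "j - 1 < 0"
      by (auto simp: algebra_simps)
    then show ?thesis by blast
  qed
  have gap: "a \<noteq> of_int k"
    if "a \<in> {of_int \<kappa><..<of_int (\<kappa> + 1)}" for a :: real and k \<kappa> :: int
    using that by (auto simp del: of_int_add)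
  have int: "complex_of_real a \<noteq> of_int k"
    if "a > 0 \<or> (\<exists>\<kappa>::int. a \<in> {of_int \<kappa><..<of_int (\<kappa> + 1)})" "k < 0" for a k
  proof
    assume "complex_of_real a = of_int k"
    then have "a = of_int k"
      by (metis of_real_eq_iff of_real_of_int_eq)
    with that gap show False by fastforce
  qed
  have "\<alpha>1 \<noteq> of_int k" "\<alpha>2 \<noteq> of_int k" if "k < 0" for k :: int
  proof -
    have "\<alpha>1 \<noteq> of_int k \<and> \<alpha>2 \<noteq> of_int k"
    proof (cases "\<alpha>1 \<notin> \<real> \<and> \<alpha>2 = cnj \<alpha>1")
      case True
      then show ?thesis
        by (metis Reals_cnj_iff Reals_of_int complex_cnj_cnj)
    next
      case False
      with assms show ?thesis
        unfolding admissible_def using int that by metis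
    qed
    then show "\<alpha>1 \<noteq> of_int k" "\<alpha>2 \<noteq> of_int k" by blast+
  qed
  with nonpos show "\<alpha>1 + 1 \<notin> \<int>\<^sub>\<le>\<^sub>0" "\<alpha>2 + 1 \<notin> \<int>\<^sub>\<le>\<^sub>0" by metis+
qed

lemma R_poly_orthogonal:
  assumes "\<alpha>3 > 0" "\<alpha>1 + 1 \<notin> \<int>\<^sub>\<le>\<^sub>0" "\<alpha>2 + 1 \<notin> \<int>\<^sub>\<le>\<^sub>0"
    and nm: "n \<noteq> m" "real n + real m < \<alpha>3 - Re (\<alpha>1 + \<alpha>2) - 1"
  shows "(\<lambda>x. R_poly \<alpha>1 \<alpha>2 \<alpha>3 n (of_nat x) * R_poly \<alpha>1 \<alpha>2 \<alpha>3 m (of_nat x) * weight \<alpha>1 \<alpha>2 \<alpha>3 x) sums 0"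
    (is "?f sums 0")
proof -
  define ev where "ev k = of_nat k * (of_real \<alpha>3 - \<alpha>1 - \<alpha>2 - 1 - of_nat k)" for k
  \<comment> \<open>The degree condition makes the second factor nonzero, so the eigenvalues differ.\<close>
  have "ev n - ev m
      = (of_nat n - of_nat m) * (of_real \<alpha>3 - \<alpha>1 - \<alpha>2 - 1 - of_nat n - of_nat m)"
    by (simp add: ev_def algebra_simps)
  moreover have "Re (of_real \<alpha>3 - \<alpha>1 - \<alpha>2 - 1 - of_nat n - of_nat m) > 0"
    using nm(2) by simp
  ultimately have nz: "ev n - ev m \<noteq> 0"
    using nm(1) by (metis eq_iff_diff_eq_0 less_irrefl mult_eq_0_iff of_nat_eq_iff zero_complex.sel(1))
  have "(\<lambda>N. \<Sum>x\<le>N. (ev n - ev m) * ?f x) \<longlonglongrightarrow> 0"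
  proof (rule Lim_transform_eventually [OF boundary_term_tendsto_0 [OF nm]])
    show "\<forall>\<^sub>F N in sequentially.
      - (weight \<alpha>1 \<alpha>2 \<alpha>3 (Suc N) * (of_nat (Suc N) * (of_nat (Suc N) + of_real \<alpha>3)))
        * casorati (R_poly \<alpha>1 \<alpha>2 \<alpha>3 n) (R_poly \<alpha>1 \<alpha>2 \<alpha>3 m) (of_nat N)
      = (\<Sum>x\<le>N. (ev n - ev m) * ?f x)"
      unfolding summation_by_parts_D_op [OF assms(1), symmetric] D_op_R_poly [OF assms(2,3)]
      by (intro always_eventually allI sum.cong refl) (simp add: ev_def algebra_simps)
  qed
  then have "(\<lambda>x. (ev n - ev m) * ?f x) sums ((ev n - ev m) * 0)"
    by (simp add: sums_def_le)
  then show ?thesis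
    using sums_mult_iff [OF nz] by blast
qed

theorem proposition4p1:
  fixes \<alpha>1 \<alpha>2 :: complex and \<alpha>3 :: real
  assumes "admissible \<alpha>1 \<alpha>2 \<alpha>3"
  shows "(\<forall>(n::nat) (x::complex). R_poly \<alpha>1 \<alpha>2 \<alpha>3 n x =
            (\<Sum>k=0..n. pochhammer (- of_nat n) k
                 * pochhammer (of_nat n - of_real \<alpha>3 + \<alpha>1 + \<alpha>2 + 1) k * pochhammer (- x) k
                 / (pochhammer (\<alpha>1 + 1) k * pochhammer (\<alpha>2 + 1) k * fact k)))
       \<and> (\<forall>(n::nat) (x::complex). D_op \<alpha>1 \<alpha>2 \<alpha>3 (R_poly \<alpha>1 \<alpha>2 \<alpha>3 n) x =
            of_nat n * (of_real \<alpha>3 - \<alpha>1 - \<alpha>2 - 1 - of_nat n) * R_poly \<alpha>1 \<alpha>2 \<alpha>3 n x)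
       \<and> (\<forall>n m :: nat. n \<noteq> m \<and> real n + real m < \<alpha>3 - Re (\<alpha>1 + \<alpha>2) - 1 \<longrightarrow>
            (\<lambda>x::nat. R_poly \<alpha>1 \<alpha>2 \<alpha>3 n (of_nat x) * R_poly \<alpha>1 \<alpha>2 \<alpha>3 m (of_nat x)
                 * weight \<alpha>1 \<alpha>2 \<alpha>3 x) sums 0)"
proof (intro conjI allI impI)
  note adm = admissible_imp [OF assms]
  fix n :: nat and x :: complex
  show "R_poly \<alpha>1 \<alpha>2 \<alpha>3 n x =
      (\<Sum>k=0..n. pochhammer (- of_nat n) k
        * pochhammer (of_nat n - of_real \<alpha>3 + \<alpha>1 + \<alpha>2 + 1) k * pochhammer (- x) k
        / (pochhammer (\<alpha>1 + 1) k * pochhammer (\<alpha>2 + 1) k * fact k))"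
    by (simp add: R_poly_eq_sum r_coeff_def atMost_atLeast0)
  show "D_op \<alpha>1 \<alpha>2 \<alpha>3 (R_poly \<alpha>1 \<alpha>2 \<alpha>3 n) x =
      of_nat n * (of_real \<alpha>3 - \<alpha>1 - \<alpha>2 - 1 - of_nat n) * R_poly \<alpha>1 \<alpha>2 \<alpha>3 n x"
    using adm(2,3) by (rule D_op_R_poly)
  fix m :: nat
  assume "n \<noteq> m \<and> real n + real m < \<alpha>3 - Re (\<alpha>1 + \<alpha>2) - 1"
  then show "(\<lambda>x::nat. R_poly \<alpha>1 \<alpha>2 \<alpha>3 n (of_nat x) * R_poly \<alpha>1 \<alpha>2 \<alpha>3 m (of_nat x)
      * weight \<alpha>1 \<alpha>2 \<alpha>3 x) sums 0"
    using R_poly_orthogonal [OF adm] by blast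
qed

end
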